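(* Let $m$ be any positive odd integer and put $\varphi_k=\cos\left(\frac{(2k+1)\pi}{m}\right)$ for $0\le k\le\frac{m-3}{2}$. Then $$\int_{0}^{1}\frac{\log(x^m+1)}{x^2+1}\,dx=\frac{m\pi}{8}\log 2-\frac{(m-1)\operatorname{G}}{2}+\frac{\pi}{4}\sum_{k=0}^{\frac{m-3}{2}}\log\left(1+\sin\frac{(2k+1)\pi}{m}\right)+\sum_{k=0}^{\frac{m-3}{2}}\operatorname{Ti}_2\left(\frac{1}{\varphi_k}\left(\sqrt{1-\varphi_k^2}-1\right)\right).$$
   Context: $\operatorname{G}=\sum_{k=0}^{\infty}\frac{(-1)^k}{(2k+1)^2}$ is Catalan's constant. The inverse tangent integral is $\operatorname{Ti}_2(x)=\int_{0}^{x}\frac{\arctan u}{u}\,du$ for real $x$ (the integrand being extended by the value $1$ at $u=0$). An empty sum (which occurs for $m=1$) is interpreted as zero. *)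

theory Defs
  imports "HOL-Analysis.Analysis"
begin

definition catalan_constant :: real where
  "catalan_constant = (\<Sum>k. (-1) ^ k / (2 * real k + 1)\<^sup>2)"

text \<open>The interval integral is oriented, so the definition covers negative \<open>x\<close> as well.\<close>

definition Ti2 :: "real \<Rightarrow> real" where
  "Ti2 x = (LBINT u=0..x. (if u = 0 then 1 else arctan u / u))"

end

(* Since m is odd, x^m + 1 is (x + 1) times the product of the quadratics x^2 - 2 x cos t + 1
   for t = (2k+1) pi / m < pi, so the integral splits into integrals J(t) of
   ln (x^2 - 2 x cos t + 1) / (x^2 + 1). Differentiating under the integral sign gives J'(t) in
   closed form, and J agrees with
   pi/4 ln 2 - G + pi/4 ln (1 + sin t) + Ti2 (tan (t/2 - pi/4)) on (0, pi]: the derivatives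
   coincide except where cos t = 0, and at t = pi the claim reduces to Ti2 1 = G and to
   the integral of ln (1 + x) / (1 + x^2) over [0, 1] being pi/8 ln 2. *)

theory Submission
  imports Defs
begin

section \<open>Factorisation of \<open>x ^ m + 1\<close> for odd \<open>m\<close>\<close>

text \<open>Two polynomials of degree at most \<open>n\<close> with the same coefficient at degree
  \<open>n\<close> coincide once they agree at \<open>n\<close> points; here both vanish at the
  \<open>n\<close> roots of unity.\<close>

lemma power_minus_one_eq_prod_roots_unity:
  fixes z :: complex
  assumes "n > 0"
  shows "z ^ n - 1 = (\<Prod>k<n. z - cis (2 * pi * real k / real n))"
proof -
  let ?r = "\<lambda>k. cis (2 * pi * real k / real n)"
  define q where "q = (\<Prod>k<n. [:- ?r k, 1:])"
  have bij: "bij_betw ?r {..<n} {z. z ^ n = 1}"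
    by (rule Complex.bij_betw_roots_unity[OF assms])
  have deg: "degree q = n"
    unfolding q_def by (subst degree_prod_eq_sum_degree) auto
  have lead: "coeff q n = 1"
    using deg lead_coeff_prod[of "\<lambda>k. [:- ?r k, 1:]" "{..<n}"] by (simp add: q_def)
  have "monom 1 n - 1 = q"
  proof (rule poly_eqI_degree_lead_coeff)
    show "coeff (monom 1 n - 1) n = coeff q n"
      using assms lead by simp
    show "n \<le> card {z :: complex. z ^ n = 1}"
      using card_roots_unity_eq[OF assms] by simp
    show "degree (monom 1 n - 1 :: complex poly) \<le> n"
      by (rule degree_diff_le) (auto simp: degree_monom_le)
    show "degree q \<le> n" using deg by simp
    fix w :: complex assume w: "w \<in> {z. z ^ n = 1}"
    then obtain k where "k < n" "w = ?r k"
      using bij by (auto simp: bij_betw_def)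
    then have "poly q w = 0"
      by (auto simp: q_def poly_prod prod_zero_iff)
    then show "poly (monom 1 n - 1) w = poly q w"
      using w by (simp add: poly_monom)
  qed
  then have "poly (monom 1 n - 1) z = poly q z" by simp
  then show ?thesis by (simp add: q_def poly_prod poly_monom)
qed

text \<open>Evaluating the previous factorisation at \<open>- z\<close> and pulling out the sign
  (\<open>m\<close> is odd) gives linear factors \<open>z + r k\<close>. The root 1 yields
  \<open>x + 1\<close>, and each other root is paired with its conjugate into a real
  quadratic.\<close>

lemma odd_power_plus_one_eq_prod:
  fixes x :: real
  assumes m: "m = 2 * n + 1"
  shows "x ^ m + 1 =
    (x + 1) * (\<Prod>k<n. x\<^sup>2 - 2 * x * cos ((2 * real k + 1) * pi / real m) + 1)"
proof -
  define r where "r k = cis (2 * pi * real k / real m)" for k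
  define z where "z = complex_of_real x"
  have m0: "m > 0" using m by simp
  have "(- z) ^ m - 1 = (\<Prod>k<m. - z - r k)"
    unfolding r_def by (rule power_minus_one_eq_prod_roots_unity[OF m0])
  also have "\<dots> = (\<Prod>k<m. - 1 * (z + r k))" by simp
  also have "\<dots> = (- 1) ^ m * (\<Prod>k<m. z + r k)"
    by (subst prod.distrib) simp
  finally have "z ^ m + 1 = (\<Prod>k<m. z + r k)"
    using m by (simp add: field_simps)
  \<comment> \<open>Reflection \<open>k \<mapsto> m - k\<close> is conjugation of roots; it
    exchanges \<open>{1..n}\<close> with the remaining nonzero indices.\<close>
  also have "{..<m} = insert 0 ({1..n} \<union> (\<lambda>k. m - k) ` {1..n})"
  proof (intro equalityI subsetI)
    fix k assume k: "k \<in> {..<m}"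
    show "k \<in> insert 0 ({1..n} \<union> (\<lambda>k. m - k) ` {1..n})"
    proof (cases "k \<le> n")
      case False
      then have "m - k \<in> {1..n}" "k = m - (m - k)" using k m by auto
      then show ?thesis by blast
    qed auto
  qed (use m in auto)
  also have "(\<Prod>k\<in>\<dots>. z + r k) = (z + r 0) * ((\<Prod>k\<in>{1..n}. z + r k) * (\<Prod>k\<in>(\<lambda>k. m - k) ` {1..n}. z + r k))"
    by (subst prod.insert, simp, use m in force, subst prod.union_disjoint) (use m in auto)
  also have "(\<Prod>k\<in>(\<lambda>k. m - k) ` {1..n}. z + r k) = (\<Prod>k\<in>{1..n}. z + r (m - k))"
    by (subst prod.reindex) (use m in \<open>auto simp: inj_on_def\<close>)
  also have "(\<Prod>k\<in>{1..n}. z + r k) * (\<Prod>k\<in>{1..n}. z + r (m - k))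
      = (\<Prod>k\<in>{1..n}. (z + r k) * (z + r (m - k)))"
    by (simp add: prod.distrib)
  \<comment> \<open>Reversing the order produces the odd multiples of \<open>pi / m\<close>: since
    \<open>2 * (n - k) = m - (2 * k + 1)\<close>, the root with index \<open>n - k\<close> has angle
    \<open>pi - (2 * k + 1) * pi / m\<close>, which also flips the sign of the cosine.\<close>
  also have "\<dots> = (\<Prod>k<n. (z + r (n - k)) * (z + r (m - (n - k))))"
    by (rule prod.reindex_bij_witness[of _ "\<lambda>k. n - k" "\<lambda>k. n - k"]) auto
  also have "\<dots> = (\<Prod>k<n. of_real (x\<^sup>2 - 2 * x * cos ((2 * real k + 1) * pi / real m) + 1))"
  proof (rule prod.cong[OF refl])
    fix k assume "k \<in> {..<n}"
    then have k: "k < n" by simp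
    define j where "j = n - k"
    have j: "j \<le> m" using m j_def by simp
    have "2 * pi * real (m - j) / real m = 2 * pi - 2 * pi * real j / real m"
      using m0 j by (simp add: of_nat_diff field_simps)
    then have conj: "r (m - j) = cnj (r j)"
      by (simp add: r_def cis_cnj cis_divide[symmetric] del: cis_divide) (simp add: divide_inverse)
    have "2 * pi * real j / real m = pi - (2 * real k + 1) * pi / real m"
      using m0 k by (simp add: j_def m of_nat_diff field_simps)
    then have c: "cos (2 * pi * real j / real m) = - cos ((2 * real k + 1) * pi / real m)"
      by simp
    have "(z + r j) * (z + r (m - j)) = z\<^sup>2 + z * (r j + cnj (r j)) + r j * cnj (r j)"
      by (simp add: conj algebra_simps power2_eq_square)
    also have "r j * cnj (r j) = 1"
      by (simp add: r_def cis_cnj cis_mult)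
    also have "r j + cnj (r j) = of_real (2 * cos (2 * pi * real j / real m))"
      by (simp add: complex_add_cnj r_def)
    finally show "(z + r (n - k)) * (z + r (m - (n - k))) =
        of_real (x\<^sup>2 - 2 * x * cos ((2 * real k + 1) * pi / real m) + 1)"
      by (simp add: c z_def flip: j_def)
  qed
  finally have "complex_of_real (x ^ m + 1) = of_real ((x + 1) *
      (\<Prod>k<n. x\<^sup>2 - 2 * x * cos ((2 * real k + 1) * pi / real m) + 1))"
    by (simp add: z_def r_def)
  then show ?thesis by (simp only: of_real_eq_iff)
qed

section \<open>The inverse tangent integral: its derivative and its value at 1\<close>

lemma isCont_arctan_over_self:
  "isCont (\<lambda>u::real. if u = 0 then 1 else arctan u / u) x"
proof (cases "x = 0")
  case True
  have "(arctan has_field_derivative 1) (at 0)"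
    using DERIV_arctan[of 0] by simp
  then have "(\<lambda>u. arctan u / u) \<midarrow>0\<rightarrow> 1"
    by (simp add: has_field_derivative_iff)
  then have "(\<lambda>u. if u = 0 then 1 else arctan u / u) \<midarrow>0\<rightarrow> 1"
    by (rule Lim_transform_eventually) (simp add: eventually_at_filter)
  then show ?thesis using True by (simp add: isCont_def)
next
  case False
  have "isCont (\<lambda>u. arctan u / u) x"
    using False by (intro continuous_intros) auto
  moreover have "\<forall>\<^sub>F u in nhds x. (if u = 0 then 1 else arctan u / u) = arctan u / u"
    using t1_space_nhds[OF False] by eventually_elim simp
  ultimately show ?thesis by (simp add: isCont_cong)
qed

lemma DERIV_Ti2:
  "(Ti2 has_real_derivative (if x = 0 then 1 else arctan x / x)) (at x)"
proof -
  let ?f = "\<lambda>u::real. if u = 0 then 1 else arctan u / u"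
  \<comment> \<open>Any bound above \<open>\<bar>x\<bar>\<close> serves: \<open>[-b, b]\<close>
    contains the base point 0 and has \<open>x\<close> in its interior, so the one-interval
    derivative becomes two-sided.\<close>
  define b where "b = \<bar>x\<bar> + 1"
  have "((\<lambda>u. LBINT y=(0::real)..u. ?f y) has_vector_derivative ?f x) (at x within {-b..b})"
    by (rule interval_integral_FTC2)
       (auto simp: b_def intro!: continuous_at_imp_continuous_on isCont_arctan_over_self)
  then have "(Ti2 has_vector_derivative ?f x) (at x within {-b..b})"
    by (simp add: Ti2_def[abs_def] zero_ereal_def)
  moreover have "at x within {-b..b} = at x"
    by (rule at_within_interior) (auto simp: b_def)
  ultimately show ?thesis
    by (simp add: has_real_derivative_iff_has_vector_derivative)
qed

text \<open>With \<open>?p\<close> the antiderivative of \<open>t ^ n\<close> vanishing at 0, both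
  \<open>?p - f\<close> and \<open>?p + f\<close> are nondecreasing and start at 0. This integrates
  remainder bounds, first for \<open>arctan\<close> and then for \<open>Ti2\<close>.\<close>

lemma abs_le_power_of_abs_derivative_le:
  fixes f f' :: "real \<Rightarrow> real"
  assumes "0 \<le> x" "f 0 = 0"
    and deriv: "\<And>t. 0 \<le> t \<Longrightarrow> t \<le> x \<Longrightarrow> (f has_real_derivative f' t) (at t)"
    and bound: "\<And>t. 0 \<le> t \<Longrightarrow> t \<le> x \<Longrightarrow> \<bar>f' t\<bar> \<le> t ^ n"
  shows "\<bar>f x\<bar> \<le> x ^ Suc n / real (Suc n)"
proof -
  let ?p = "\<lambda>t::real. t ^ Suc n / real (Suc n)"
  have p: "(?p has_real_derivative t ^ n) (at t)" for t
    using DERIV_cdivide[OF DERIV_pow[of "Suc n" t], of "real (Suc n)"]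
    by (simp del: of_nat_Suc)
  have "?p 0 - f 0 \<le> ?p x - f x"
  proof (rule DERIV_nonneg_imp_nondecreasing[OF assms(1)])
    fix t assume t: "0 \<le> t" "t \<le> x"
    show "\<exists>y. ((\<lambda>t. ?p t - f t) has_real_derivative y) (at t) \<and> 0 \<le> y"
      using DERIV_diff[OF p deriv[OF t]] bound[OF t] by (intro exI[of _ "t ^ n - f' t"]) auto
  qed
  moreover have "?p 0 + f 0 \<le> ?p x + f x"
  proof (rule DERIV_nonneg_imp_nondecreasing[OF assms(1)])
    fix t assume t: "0 \<le> t" "t \<le> x"
    show "\<exists>y. ((\<lambda>t. ?p t + f t) has_real_derivative y) (at t) \<and> 0 \<le> y"
      using DERIV_add[OF p deriv[OF t]] bound[OF t] by (intro exI[of _ "t ^ n + f' t"]) auto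
  qed
  ultimately show ?thesis using assms(2) by simp
qed

text \<open>The derivative of the error is the remainder of a geometric series with ratio
  \<open>- t^2\<close>, namely \<open>(- 1) ^ n * t ^ (2 * n) / (1 + t^2)\<close>, which is at most
  \<open>t ^ (2 * n)\<close> in modulus.\<close>

lemma abs_arctan_minus_partial_sum_le:
  assumes "0 \<le> (x::real)"
  shows "\<bar>arctan x - (\<Sum>k<n. (- 1) ^ k * x ^ (2 * k + 1) / (2 * real k + 1))\<bar>
    \<le> x ^ (2 * n + 1) / (2 * real n + 1)"
proof -
  let ?f = "\<lambda>x. arctan x - (\<Sum>k<n. (- 1) ^ k * x ^ (2 * k + 1) / (2 * real k + 1))"
  let ?f' = "\<lambda>t::real. (- 1) ^ n * t ^ (2 * n) / (1 + t\<^sup>2)"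
  have geo: "(\<Sum>k<n. (- 1) ^ k * t ^ (2 * k)) = (1 - (- 1) ^ n * t ^ (2 * n)) / (1 + t\<^sup>2)" for t :: real
  proof -
    have "1 + t\<^sup>2 > 0" by (simp add: add_pos_nonneg)
    then have "- t\<^sup>2 \<noteq> 1" by linarith
    from sum_gp_strict[of "- t\<^sup>2" n] this show ?thesis
      by (simp add: power_minus[of "t\<^sup>2"] power_mult)
  qed
  have "\<bar>?f x\<bar> \<le> x ^ Suc (2 * n) / real (Suc (2 * n))"
  proof (rule abs_le_power_of_abs_derivative_le[OF assms])
    show "?f 0 = 0" by simp
    fix t :: real
    have pos: "1 + t\<^sup>2 > 0" by (simp add: add_pos_nonneg)
    have "((\<lambda>x. (- 1) ^ k * x ^ (2 * k + 1) / (2 * real k + 1)) has_real_derivative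
        (- 1) ^ k * t ^ (2 * k)) (at t)" for k
    proof -
      have "2 * real k + 1 \<noteq> 0" by linarith
      moreover define e where "e = 2 * real k + 1"
      ultimately show ?thesis
        using DERIV_cdivide[OF DERIV_cmult[OF DERIV_pow[of "2 * k + 1" t], of "(- 1) ^ k"], of e]
        by (simp add: add.commute)
    qed
    then have "(?f has_real_derivative inverse (1 + t\<^sup>2) - (\<Sum>k<n. (- 1) ^ k * t ^ (2 * k))) (at t)"
      by (intro DERIV_diff DERIV_arctan DERIV_sum) auto
    also have "inverse (1 + t\<^sup>2) - (\<Sum>k<n. (- 1) ^ k * t ^ (2 * k)) = ?f' t"
      unfolding geo by (simp add: field_simps flip: diff_divide_distrib)
    finally show "(?f has_real_derivative ?f' t) (at t)" .
    show "\<bar>?f' t\<bar> \<le> t ^ (2 * n)" if "0 \<le> t"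
    proof -
      have "t ^ (2 * n) / (1 + t\<^sup>2) \<le> t ^ (2 * n) / 1"
        using that pos by (intro divide_left_mono) auto
      then show ?thesis using that pos by (simp add: abs_mult power_abs)
    qed
  qed
  then show ?thesis by (simp add: add.commute)
qed

text \<open>Dividing the remainder bound for \<open>arctan\<close> by \<open>t\<close> and
  integrating once more bounds the error of the n-th partial sum at the end point 1 by
  \<open>1 / (2 * n + 1)\<close>, so the series of Catalan's constant sums to
  \<open>Ti2 1\<close>.\<close>

lemma Ti2_1: "Ti2 1 = catalan_constant"
proof -
  have bound: "\<bar>Ti2 1 - (\<Sum>k<n. (- 1) ^ k / (2 * real k + 1)\<^sup>2)\<bar> \<le> inverse (real (Suc n))" for n
  proof -
    let ?f = "\<lambda>x. Ti2 x - (\<Sum>k<n. (- 1) ^ k * x ^ (2 * k + 1) / (2 * real k + 1)\<^sup>2)"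
    let ?f' = "\<lambda>t. (if t = 0 then 1 else arctan t / t)
      - (\<Sum>k<n. (- 1) ^ k * t ^ (2 * k) / (2 * real k + 1))"
    have "\<bar>?f 1\<bar> \<le> 1 ^ Suc (2 * n) / real (Suc (2 * n))"
    proof (rule abs_le_power_of_abs_derivative_le[where f = ?f and f' = ?f'])
      show "?f 0 = 0" by (simp add: Ti2_def zero_ereal_def)
      fix t :: real assume t: "0 \<le> t"
      have "((\<lambda>x. (- 1) ^ k * x ^ (2 * k + 1) / (2 * real k + 1)\<^sup>2) has_real_derivative
          (- 1) ^ k * t ^ (2 * k) / (2 * real k + 1)) (at t)" for k
      proof -
        have "2 * real k + 1 \<noteq> 0" by linarith
        moreover define e where "e = 2 * real k + 1"
        ultimately show ?thesis
          using DERIV_cdivide[OF DERIV_cmult[OF DERIV_pow[of "2 * k + 1" t], of "(- 1) ^ k"], of "e\<^sup>2"]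
          by (simp add: power2_eq_square add.commute)
      qed
      then show "(?f has_real_derivative ?f' t) (at t)"
        by (intro DERIV_diff DERIV_Ti2 DERIV_sum) auto
      show "\<bar>?f' t\<bar> \<le> t ^ (2 * n)"
      proof (cases "t = 0")
        \<comment> \<open>At \<open>t = 0\<close> only the constant term of the sum survives and
          cancels the default value 1; for \<open>n = 0\<close> the sum is empty and the bound is
          \<open>0 ^ 0 = 1\<close>.\<close>
        case True
        then show ?thesis
          by (cases n) (simp_all add: sum.lessThan_Suc_shift power_0_left del: sum.lessThan_Suc)
      next
        case False
        then have t0: "t > 0" using t by simp
        let ?g = "arctan t - (\<Sum>k<n. (- 1) ^ k * t ^ (2 * k + 1) / (2 * real k + 1))"
        have "?f' t = ?g / t"
          using False by (simp add: diff_divide_distrib sum_divide_distrib)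
        also have "\<bar>\<dots>\<bar> \<le> (t ^ (2 * n + 1) / (2 * real n + 1)) / t"
          using abs_arctan_minus_partial_sum_le[OF t, of n] t0 
          by (simp only: abs_divide abs_of_pos divide_right_mono less_imp_le)
        also have "\<dots> = t ^ (2 * n) / (2 * real n + 1)" using t0 by simp
        also have "\<dots> \<le> t ^ (2 * n) / 1" using t0 by (intro divide_left_mono) auto
        finally show ?thesis by simp
      qed
    qed simp
    also have "\<dots> \<le> inverse (real (Suc n))" by (simp add: field_simps)
    finally show ?thesis by simp
  qed
  have "(\<lambda>n. Ti2 1 - (\<Sum>k<n. (- 1) ^ k / (2 * real k + 1)\<^sup>2)) \<longlonglongrightarrow> 0"
    by (rule tendsto_rabs_zero_cancel, rule tendsto_sandwich[OF _ _ tendsto_const LIMSEQ_inverse_real_of_nat])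
       (use bound in auto)
  then have "(\<lambda>n. Ti2 1 - (Ti2 1 - (\<Sum>k<n. (- 1) ^ k / (2 * real k + 1)\<^sup>2))) \<longlonglongrightarrow> Ti2 1 - 0"
    by (intro tendsto_diff tendsto_const)
  then have "(\<lambda>k. (- 1) ^ k / (2 * real k + 1)\<^sup>2) sums Ti2 1"
    by (simp add: sums_def)
  then show ?thesis by (simp add: catalan_constant_def sums_iff)
qed

section \<open>The parametric integral and its derivative\<close>

text \<open>Splitting off \<open>(x - 1)^2\<close> leaves \<open>2 * x * (1 - cos \<theta>)\<close>;
  the first is positive for \<open>x \<noteq> 1\<close>, the second at \<open>x = 1\<close>. The
  range reaches beyond \<open>pi\<close> so that \<open>pi\<close> is an interior parameter.\<close>

lemma quadratic_pos:
  assumes "0 < \<theta>" "\<theta> < 2 * pi" "0 \<le> x"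
  shows "0 < x\<^sup>2 - 2 * x * cos \<theta> + 1"
proof -
  have "sin (\<theta> / 2) > 0" using assms by (intro sin_gt_zero) auto
  then have "cos \<theta> < 1" using cos_double_sin[of "\<theta> / 2"] by simp
  have eq: "x\<^sup>2 - 2 * x * cos \<theta> + 1 = (x - 1)\<^sup>2 + 2 * x * (1 - cos \<theta>)"
    by (simp add: power2_eq_square algebra_simps)
  show ?thesis
  proof (cases "x = 1")
    case False
    then have "(x - 1)\<^sup>2 > 0" by simp
    moreover have "2 * x * (1 - cos \<theta>) \<ge> 0"
      using assms(3) \<open>cos \<theta> < 1\<close> by simp
    ultimately show ?thesis unfolding eq by linarith
  qed (use \<open>cos \<theta> < 1\<close> in simp)
qed

lemma square_plus_one_neq_0 [simp]: "(x::real)\<^sup>2 + 1 \<noteq> 0"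
  using zero_le_power2[of x] by linarith

text \<open>This is \<open>J\<close>; the argument of the logarithm is the squared distance of
  \<open>x\<close> from the unit circle point of angle \<open>\<theta>\<close>.\<close>

definition log_quadratic_integral :: "real \<Rightarrow> real" where
  "log_quadratic_integral \<theta> =
     integral {0..1} (\<lambda>x. ln (x\<^sup>2 - 2 * x * cos \<theta> + 1) / (x\<^sup>2 + 1))"

lemma continuous_on_log_quadratic:
  assumes "0 < \<theta>" "\<theta> < 2 * pi"
  shows "continuous_on {0..1} (\<lambda>x. ln (x\<^sup>2 - 2 * x * cos \<theta> + 1) / (x\<^sup>2 + 1))"
proof -
  have "x\<^sup>2 - 2 * x * cos \<theta> + 1 \<noteq> 0" if "x \<in> {0..1}" for x
    using quadratic_pos[OF assms, of x] that by auto
  then show ?thesis by (intro continuous_intros) auto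
qed

text \<open>The Leibniz rule applies on the open interval \<open>(0, 2 * pi)\<close>, where the
  quadratic stays positive for all \<open>x\<close> in \<open>[0, 1]\<close>. In particular
  \<open>J\<close> is continuous at \<open>pi\<close>.\<close>

lemma DERIV_log_quadratic_integral:
  assumes "0 < \<theta>" "\<theta> < 2 * pi"
  shows "(log_quadratic_integral has_real_derivative
    integral {0..1} (\<lambda>x. 2 * x * sin \<theta> / ((x\<^sup>2 - 2 * x * cos \<theta> + 1) * (x\<^sup>2 + 1)))) (at \<theta>)"
proof -
  let ?U = "{0<..<2 * pi}"
  let ?f = "\<lambda>\<theta> x. ln (x\<^sup>2 - 2 * x * cos \<theta> + 1) / (x\<^sup>2 + 1)"
  let ?f' = "\<lambda>\<theta> x. 2 * x * sin \<theta> / ((x\<^sup>2 - 2 * x * cos \<theta> + 1) * (x\<^sup>2 + 1))"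
  have "((\<lambda>\<theta>. integral (cbox 0 1) (?f \<theta>)) has_field_derivative integral (cbox 0 1) (?f' \<theta>))
      (at \<theta> within ?U)"
  proof (rule leibniz_rule_field_derivative)
    fix \<theta> x :: real assume t: "\<theta> \<in> ?U" and x: "x \<in> cbox 0 1"
    have pos: "x\<^sup>2 - 2 * x * cos \<theta> + 1 > 0"
      using t x by (intro quadratic_pos) auto
    have "((\<lambda>\<theta>. ln (x\<^sup>2 - 2 * x * cos \<theta> + 1)) has_real_derivative
        2 * x * sin \<theta> / (x\<^sup>2 - 2 * x * cos \<theta> + 1)) (at \<theta>)"
      using pos by (auto intro!: derivative_eq_intros)
    from DERIV_cdivide[OF this, of "x\<^sup>2 + 1"]
    show "((\<lambda>\<theta>. ?f \<theta> x) has_field_derivative ?f' \<theta> x) (at \<theta> within ?U)"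
      by (simp add: has_field_derivative_at_within)
  next
    fix \<theta> :: real assume "\<theta> \<in> ?U"
    then show "?f \<theta> integrable_on cbox 0 1"
      using continuous_on_log_quadratic by (auto intro!: integrable_continuous_real)
  next
    have "x\<^sup>2 - 2 * x * cos \<theta> + 1 \<noteq> 0" if "\<theta> \<in> ?U" "x \<in> {0..1}" for \<theta> x
      using quadratic_pos[of \<theta> x] that by auto
    then show "continuous_on (?U \<times> cbox 0 1) (\<lambda>(\<theta>, x). ?f' \<theta> x)"
      unfolding split_beta by (intro continuous_intros) auto
  qed (use assms in auto)
  then show ?thesis
    using assms by (simp add: at_within_open[of \<theta> ?U] log_quadratic_integral_def[abs_def])
qed

text \<open>For \<open>cos \<theta> \<noteq> 0\<close>, partial fractions turn the integrand into
  \<open>tan \<theta>\<close> times the difference of the reciprocals of the two quadratics, and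
  each reciprocal integrates to an arctangent. Half-angle and complement formulas evaluate these at
  the end points.\<close>

lemma integral_derivative_log_quadratic:
  assumes "0 < \<theta>" "\<theta> < pi" "cos \<theta> \<noteq> 0"
  shows "integral {0..1} (\<lambda>x. 2 * x * sin \<theta> / ((x\<^sup>2 - 2 * x * cos \<theta> + 1) * (x\<^sup>2 + 1)))
    = (pi / 2 - \<theta> / 2) / cos \<theta> - pi / 4 * tan \<theta>"
proof -
  let ?s = "sin \<theta>" and ?c = "cos \<theta>"
  have s: "?s > 0" using assms by (intro sin_gt_zero)
  let ?P = "\<lambda>x. tan \<theta> * (arctan ((x - ?c) / ?s) / ?s - arctan x)"
  have "((\<lambda>x. 2 * x * ?s / ((x\<^sup>2 - 2 * x * ?c + 1) * (x\<^sup>2 + 1))) has_integral ?P 1 - ?P 0) {0..1}"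
  proof (rule fundamental_theorem_of_calculus)
    fix x :: real assume "x \<in> {0..1}"
    then have Q: "x\<^sup>2 - 2 * x * ?c + 1 > 0"
      using assms by (intro quadratic_pos) auto
    have "?s\<^sup>2 + (x - ?c)\<^sup>2 = x\<^sup>2 - 2 * x * ?c + (?s\<^sup>2 + ?c\<^sup>2)"
      by (simp add: power2_eq_square algebra_simps)
    then have sq: "?s\<^sup>2 + (x - ?c)\<^sup>2 = x\<^sup>2 - 2 * x * ?c + 1" by simp
    have "((\<lambda>x. arctan ((x - ?c) / ?s)) has_real_derivative
        inverse (1 + ((x - ?c) / ?s)\<^sup>2) * (1 / ?s)) (at x)"
      by (rule DERIV_chain2[OF DERIV_arctan]) (use s in \<open>auto intro!: derivative_eq_intros\<close>)
    also have "1 + ((x - ?c) / ?s)\<^sup>2 = (?s\<^sup>2 + (x - ?c)\<^sup>2) / ?s\<^sup>2"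
      using s by (simp add: field_simps)
    finally have d: "((\<lambda>x. arctan ((x - ?c) / ?s)) has_real_derivative
        ?s / (x\<^sup>2 - 2 * x * ?c + 1)) (at x)"
      using s by (simp add: sq) (simp add: power2_eq_square)
    have "(?P has_real_derivative
        tan \<theta> * (?s / (x\<^sup>2 - 2 * x * ?c + 1) / ?s - inverse (1 + x\<^sup>2))) (at x)"
      by (intro DERIV_cmult DERIV_diff DERIV_cdivide d DERIV_arctan)
    also have "tan \<theta> * (?s / (x\<^sup>2 - 2 * x * ?c + 1) / ?s - inverse (1 + x\<^sup>2))
        = tan \<theta> * (1 / (x\<^sup>2 - 2 * x * ?c + 1) - 1 / (x\<^sup>2 + 1))"
      using s by (simp add: divide_inverse add.commute)
    also have "1 / (x\<^sup>2 - 2 * x * ?c + 1) - 1 / (x\<^sup>2 + 1)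
        = 2 * x * ?c / ((x\<^sup>2 - 2 * x * ?c + 1) * (x\<^sup>2 + 1))"
      using Q by (subst diff_frac_eq) auto
    also have "tan \<theta> * \<dots> = 2 * x * ?s / ((x\<^sup>2 - 2 * x * ?c + 1) * (x\<^sup>2 + 1))"
      using assms(3) by (simp add: tan_def)
    finally show "(?P has_vector_derivative 2 * x * ?s / ((x\<^sup>2 - 2 * x * ?c + 1) * (x\<^sup>2 + 1)))
        (at x within {0..1})"
      by (simp add: has_real_derivative_iff_has_vector_derivative has_vector_derivative_at_within)
  qed simp
  moreover have "arctan ((1 - ?c) / ?s) = \<theta> / 2"
  proof (rule arctan_unique)
    have "sin (\<theta> / 2) \<noteq> 0" "cos (\<theta> / 2) \<noteq> 0"
      using sin_gt_zero[of "\<theta> / 2"] cos_gt_zero_pi[of "\<theta> / 2"] assms by auto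
    then show "tan (\<theta> / 2) = (1 - ?c) / ?s"
      using sin_double[of "\<theta> / 2"] cos_double_sin[of "\<theta> / 2"]
      by (simp add: tan_def field_simps power2_eq_square)
  qed (use assms in auto)
  moreover have "arctan ((0 - ?c) / ?s) = \<theta> - pi / 2"
    by (rule arctan_unique) (use assms in \<open>auto simp: tan_def sin_diff cos_diff\<close>)
  ultimately have "integral {0..1} (\<lambda>x. 2 * x * ?s / ((x\<^sup>2 - 2 * x * ?c + 1) * (x\<^sup>2 + 1)))
      = tan \<theta> * (\<theta> / 2 / ?s - pi / 4) - tan \<theta> * ((\<theta> - pi / 2) / ?s)"
    by (simp add: integral_unique arctan_one)
  also have "\<dots> = (pi / 2 - \<theta> / 2) * (tan \<theta> / ?s) - pi / 4 * tan \<theta>"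
    by (simp add: algebra_simps add_divide_distrib diff_divide_distrib)
  also have "tan \<theta> / ?s = 1 / ?c" using s by (simp add: tan_def)
  finally show ?thesis by simp
qed

section \<open>The boundary value at \<open>pi\<close>\<close>

text \<open>The substitution \<open>x = (1 - t) / (1 + t)\<close> maps the integral to \<open>pi / 4 * ln 2\<close> minus itself.\<close>

lemma integral_ln_one_plus_over_square_plus_one:
  "integral {0..1} (\<lambda>x. ln (x + 1) / (x\<^sup>2 + 1)) = pi / 8 * ln (2::real)"
proof -
  let ?f = "\<lambda>x. ln (x + 1) / (x\<^sup>2 + 1 :: real)"
  define H where "H t = integral {0..t} ?f" for t
  define g where "g t = (1 - t) / (1 + t)" for t :: real
  have contf: "continuous_on {0..1} ?f"
    by (intro continuous_intros) auto
  have contH: "continuous_on {0..1} H"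
    unfolding H_def by (intro indefinite_integral_continuous_1 integrable_continuous_real contf)
  have H': "(H has_real_derivative ?f t) (at t)" if "0 < t" "t < 1" for t
  proof -
    have "(H has_real_derivative ?f t) (at t within {0..1})"
      unfolding H_def using that by (intro integral_has_real_derivative contf) auto
    then show ?thesis using that by (simp add: at_within_Icc_at)
  qed
  \<comment> \<open>The substitution is carried out by differentiation: \<open>?F\<close> has
    derivative zero, and since \<open>g\<close> swaps 0 and 1, its end values give
    \<open>2 * H 1 = ln 2 * arctan 1\<close>.\<close>
  let ?F = "\<lambda>t. H (g t) - H t + ln 2 * arctan t"
  have "?F 1 = ?F 0"
  proof (rule DERIV_isconst_end[where f = ?F])
    show "continuous_on {0..1} ?F"
      by (intro continuous_intros contH continuous_on_compose2[OF contH])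
         (auto simp: g_def field_simps intro!: continuous_intros)
    fix t :: real assume t: "0 < t" "t < 1"
    have "(g has_real_derivative - 2 / (1 + t)\<^sup>2) (at t)"
      unfolding g_def using t by (auto intro!: derivative_eq_intros simp: power2_eq_square)
    moreover have "0 < g t" "g t < 1" using t by (auto simp: g_def)
    ultimately have "((\<lambda>t. H (g t)) has_real_derivative ?f (g t) * (- 2 / (1 + t)\<^sup>2)) (at t)"
      by (intro DERIV_chain2[OF H'])
    moreover have "?f (g t) * (- 2 / (1 + t)\<^sup>2) = ?f t - ln 2 / (t\<^sup>2 + 1)"
    proof -
      have "g t + 1 = 2 / (t + 1)" using t by (simp add: g_def field_simps)
      then have 1: "ln (g t + 1) = ln 2 - ln (t + 1)" using t by (simp add: ln_div)
      have "(g t)\<^sup>2 + 1 = ((1 - t)\<^sup>2 + (1 + t)\<^sup>2) / (1 + t)\<^sup>2"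
        using t by (simp add: g_def power_divide add_divide_distrib)
      also have "(1 - t)\<^sup>2 + (1 + t)\<^sup>2 = 2 * (t\<^sup>2 + 1)"
        by (simp add: power2_eq_square algebra_simps)
      finally have 2: "(g t)\<^sup>2 + 1 = 2 * (t\<^sup>2 + 1) / (1 + t)\<^sup>2" .
      have "(1 + t)\<^sup>2 \<noteq> 0" using t by simp
      moreover have "a / (2 * b / c) * (- 2 / c) = - a / b" if "b \<noteq> 0" "c \<noteq> 0" for a b c :: real
        using that by (simp add: field_simps)
      ultimately have "?f (g t) * (- 2 / (1 + t)\<^sup>2) = - (ln 2 - ln (t + 1)) / (t\<^sup>2 + 1)"
        unfolding 1 2 using square_plus_one_neq_0 by blast
      then show ?thesis by (simp add: diff_divide_distrib)
    qed
    ultimately show "(?F has_real_derivative 0) (at t)"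
      using t by (auto intro!: derivative_eq_intros H' simp: field_simps)
  qed simp
  moreover have "H 0 = 0" "g 0 = 1" "g 1 = 0" by (simp_all add: H_def g_def)
  ultimately have "2 * H 1 = ln 2 * arctan 1" by simp
  then show ?thesis by (simp add: H_def arctan_one mult.commute)
qed

text \<open>At \<open>pi\<close> the quadratic is \<open>(x + 1)^2\<close>, so the logarithm
  doubles.\<close>

lemma log_quadratic_integral_pi: "log_quadratic_integral pi = pi / 4 * ln 2"
proof -
  have "log_quadratic_integral pi = integral {0..1} (\<lambda>x::real. (ln (x + 1) / (x\<^sup>2 + 1)) * 2)"
    unfolding log_quadratic_integral_def
  proof (rule integral_cong)
    fix x :: real assume "x \<in> {0..1}"
    then have "ln ((x + 1)\<^sup>2) = 2 * ln (x + 1)" by (simp add: ln_realpow)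
    also have "(x + 1)\<^sup>2 = x\<^sup>2 - 2 * x * cos pi + 1"
      by (simp add: power2_eq_square algebra_simps)
    finally show "ln (x\<^sup>2 - 2 * x * cos pi + 1) / (x\<^sup>2 + 1) = (ln (x + 1) / (x\<^sup>2 + 1)) * 2"
      by simp
  qed
  then show ?thesis
    by (simp only: integral_mult_left integral_ln_one_plus_over_square_plus_one)
qed

section \<open>Closed form of the parametric integral\<close>

lemma log_quadratic_integral_eq:
  assumes "0 < \<theta>" "\<theta> \<le> pi"
  shows "log_quadratic_integral \<theta> =
    pi / 4 * ln 2 - catalan_constant + pi / 4 * ln (1 + sin \<theta>) + Ti2 (tan (\<theta> / 2 - pi / 4))"
proof -
  let ?R = "\<lambda>\<theta>. pi / 4 * ln (1 + sin \<theta>) + Ti2 (tan (\<theta> / 2 - pi / 4))"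
  let ?D = "\<lambda>\<theta>. log_quadratic_integral \<theta> - ?R \<theta>"
  have R': "(?R has_real_derivative pi / 4 * (cos \<theta> / (1 + sin \<theta>)) + 
      (if t = 0 then 1 else t / tan t) * (inverse ((cos t)\<^sup>2) * (1 / 2))) (at \<theta>)"
    if "0 < \<theta>" "\<theta> \<le> pi" "t = \<theta> / 2 - pi / 4" for \<theta> t
  proof -
    have "sin \<theta> \<ge> 0" using that by (intro sin_ge_zero) auto
    then have 1: "((\<lambda>\<theta>. ln (1 + sin \<theta>)) has_real_derivative cos \<theta> / (1 + sin \<theta>)) (at \<theta>)"
      by (auto intro!: derivative_eq_intros)
    have t: "- pi / 2 < t" "t < pi / 2" using that by auto
    then have "cos t > 0" by (intro cos_gt_zero_pi) auto
    then have 2: "((\<lambda>\<theta>. tan (\<theta> / 2 - pi / 4)) has_real_derivative inverse ((cos t)\<^sup>2) * (1 / 2)) (at \<theta>)"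
      unfolding that(3) by (intro DERIV_chain2[OF DERIV_tan]) (auto intro!: derivative_eq_intros)
    \<comment> \<open>This matches the default value of the integrand of \<open>Ti2\<close> at 0
      with the case \<open>t = 0\<close>, that is \<open>\<theta> = pi / 2\<close>.\<close>
    have "tan t = 0 \<longleftrightarrow> t = 0" using t arctan_tan[of t] by auto
    then have "(if tan t = 0 then 1 else arctan (tan t) / tan t) = (if t = 0 then 1 else t / tan t)"
      using t by (simp add: arctan_tan)
    then show ?thesis
      using DERIV_add[OF DERIV_cmult[OF 1, of "pi / 4"] DERIV_chain2[OF DERIV_Ti2 2]]
      by (simp only: that(3)[symmetric])
  qed
  have "?D pi = ?D \<theta>"
  \<comment> \<open>Finitely many exceptional points are harmless for a continuous function: at
    \<open>pi / 2\<close> the closed form of the derivative divides by zero, and at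
    \<open>pi\<close> it has not been established.\<close>
  proof (rule has_derivative_zero_unique_strong_interval[where f = ?D and a = \<theta> and b = pi])
    show "finite {pi / 2, pi}" by simp
    show "continuous_on {\<theta>..pi} ?D"
    proof (intro continuous_at_imp_continuous_on ballI)
      fix x assume x: "x \<in> {\<theta>..pi}"
      have "isCont log_quadratic_integral x"
        by (rule DERIV_isCont[OF DERIV_log_quadratic_integral]) (use assms x in auto)
      moreover have "isCont ?R x"
        by (rule DERIV_isCont[OF R']) (use assms x in auto)
      ultimately show "isCont ?D x" by (intro continuous_diff)
    qed
    fix x assume "x \<in> {\<theta>..pi} - {pi / 2, pi}"
    then have x: "0 < x" "x < pi" "x \<noteq> pi / 2" using assms by auto
    define t where "t = x / 2 - pi / 4"
    have t: "x = 2 * t + pi / 2" by (simp add: t_def)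
    have "t \<noteq> 0" using x by (simp add: t_def)
    have ct: "cos t > 0" using x by (intro cos_gt_zero_pi) (auto simp: t_def)
    have "sin t \<noteq> 0"
      using sin_eq_0_pi[of t] \<open>t \<noteq> 0\<close> x by (auto simp: t_def)
    have cx: "cos x = - 2 * sin t * cos t"
      by (simp add: t cos_add sin_double)
    have cx0: "cos x \<noteq> 0" using \<open>sin t \<noteq> 0\<close> ct by (simp add: cx)
    have sx: "sin x > 0" using x by (intro sin_gt_zero)
    \<comment> \<open>Both parts of the derivative of \<open>?R\<close> are brought to the
      denominator \<open>cos x\<close>, to be compared with the derivative of \<open>J\<close>; for
      the \<open>Ti2\<close> part this uses \<open>cos x = - sin (2 * t)\<close>.\<close>
    have "pi / 4 * (cos x / (1 + sin x)) = pi / 4 * ((1 - sin x) / cos x)"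
    proof -
      have "(cos x)\<^sup>2 = (1 + sin x) * (1 - sin x)"
        by (simp add: cos_squared_eq power2_eq_square algebra_simps)
      then have "cos x / (1 + sin x) = (1 - sin x) / cos x"
        using cx0 sx by (subst frac_eq_eq) (auto simp: power2_eq_square mult.commute)
      then show ?thesis by simp
    qed
    moreover have "t / tan t * (inverse ((cos t)\<^sup>2) * (1 / 2)) = - t / cos x"
      using \<open>sin t \<noteq> 0\<close> ct unfolding cx by (simp add: tan_def field_simps power2_eq_square)
    moreover have "pi / 4 * ((1 - sin x) / cos x) + - t / cos x
        = (pi / 2 - x / 2) / cos x - pi / 4 * tan x"
      unfolding tan_def t_def by (simp add: diff_divide_distrib right_diff_distrib)
    ultimately have "(?R has_real_derivative (pi / 2 - x / 2) / cos x - pi / 4 * tan x) (at x)"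
      using R'[OF x(1) less_imp_le[OF x(2)] t_def] \<open>t \<noteq> 0\<close> by simp
    moreover have "(log_quadratic_integral has_real_derivative
        (pi / 2 - x / 2) / cos x - pi / 4 * tan x) (at x)"
      using DERIV_log_quadratic_integral[of x] integral_derivative_log_quadratic[OF x(1,2) cx0] x
      by simp
    ultimately have "(?D has_real_derivative 0) (at x)"
      using DERIV_diff by fastforce
    then have "(?D has_derivative (\<lambda>h. 0 * h)) (at x)"
      by (simp only: has_field_derivative_def)
    then show "(?D has_derivative (\<lambda>h. 0)) (at x within {\<theta>..pi})"
      by (simp add: has_derivative_at_withinI)
  qed (use assms in auto)
  \<comment> \<open>At \<open>pi\<close> the term \<open>ln (1 + sin pi)\<close> vanishes and the
    argument of \<open>Ti2\<close> is \<open>tan (pi / 4) = 1\<close>, which contributes Catalan's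
    constant.\<close>
  then show ?thesis
    by (simp add: log_quadratic_integral_pi tan_45 Ti2_1)
qed

section \<open>Summation over the quadratic factors\<close>

theorem theorem2p2:
  fixes m :: nat and \<phi> :: "nat \<Rightarrow> real"
  assumes "odd m"
    and "\<And>k. k < (m - 1) div 2 \<Longrightarrow> \<phi> k = cos ((2 * real k + 1) * pi / real m)"
  shows "(LBINT x=0..1. ln (x ^ m + 1) / (x\<^sup>2 + 1)) =
    real m * pi / 8 * ln 2 - (real m - 1) * catalan_constant / 2
    + pi / 4 * (\<Sum>k<(m - 1) div 2. ln (1 + sin ((2 * real k + 1) * pi / real m)))
    + (\<Sum>k<(m - 1) div 2. Ti2 (1 / \<phi> k * (sqrt (1 - (\<phi> k)\<^sup>2) - 1)))"
proof -
  define n where "n = (m - 1) div 2"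
  have m: "m = 2 * n + 1" using assms(1) by (auto simp: n_def elim: oddE)
  define \<theta> where "\<theta> k = (2 * real k + 1) * pi / real m" for k
  have \<theta>: "0 < \<theta> k" "\<theta> k < pi" if "k < n" for k
    using that by (auto simp: \<theta>_def m field_simps intro: add_pos_nonneg)
  have Ti2_eq: "Ti2 (1 / \<phi> k * (sqrt (1 - (\<phi> k)\<^sup>2) - 1)) = Ti2 (tan (\<theta> k / 2 - pi / 4))"
    if k: "k < n" for k
  proof -
    define t where "t = \<theta> k / 2 - pi / 4"
    have t: "\<theta> k = 2 * t + pi / 2" by (simp add: t_def)
    have \<phi>: "\<phi> k = cos (\<theta> k)"
      using assms(2) k by (simp add: \<theta>_def n_def)
    \<comment> \<open>\<open>t = 0\<close> would mean \<open>\<theta> k = pi / 2\<close>, hence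
      \<open>2 * (2 * k + 1) = m\<close>, against \<open>m\<close> being odd. So
      \<open>\<phi> k\<close> is nonzero and the division by it is genuine.\<close>
    have "t \<noteq> 0"
    proof
      assume "t = 0"
      then have "pi * ((2 * real k + 1) * 2) = pi * real m"
        using m by (simp add: t_def \<theta>_def field_simps)
      then have "(2 * real k + 1) * 2 = real m" by (subst (asm) mult_cancel_left) simp
      then have "real ((2 * k + 1) * 2) = real m" by simp
      then have "(2 * k + 1) * 2 = m" by (simp only: of_nat_eq_iff)
      then show False using m by presburger
    qed
    have ct: "cos t > 0" using \<theta>[OF k] by (intro cos_gt_zero_pi) (auto simp: t_def)
    have "sin t \<noteq> 0"
      using sin_eq_0_pi[of t] \<open>t \<noteq> 0\<close> \<theta>[OF k] by (auto simp: t_def)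
    have c: "cos (\<theta> k) = - 2 * sin t * cos t" by (simp add: t cos_add sin_double)
    have s: "sin (\<theta> k) = 1 - 2 * (sin t)\<^sup>2" by (simp add: t sin_add cos_double_sin)
    \<comment> \<open>Positivity of the sine selects the root: the argument is
      \<open>(sin (\<theta> k) - 1) / cos (\<theta> k)\<close>, and the double-angle formulas in
      \<open>t\<close> reduce it to \<open>tan t\<close>.\<close>
    have "sin (\<theta> k) > 0" using \<theta>[OF k] by (intro sin_gt_zero)
    then have "sqrt (1 - (\<phi> k)\<^sup>2) = sin (\<theta> k)"
      unfolding \<phi> by (simp add: sin_squared_eq[symmetric])
    then have "1 / \<phi> k * (sqrt (1 - (\<phi> k)\<^sup>2) - 1) = 1 / cos (\<theta> k) * (sin (\<theta> k) - 1)"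
      unfolding \<phi> by (simp only:)
    also have "\<dots> = tan t"
      using ct \<open>sin t \<noteq> 0\<close> unfolding c s by (simp add: tan_def field_simps power2_eq_square)
    finally show ?thesis by (simp add: t_def)
  qed
  let ?f = "\<lambda>x. ln (x ^ m + 1) / (x\<^sup>2 + 1 :: real)"
  let ?q = "\<lambda>k x. ln (x\<^sup>2 - 2 * x * cos (\<theta> k) + 1) / (x\<^sup>2 + 1 :: real)"
  have pos: "x ^ m + 1 > 0" if "0 \<le> x" for x :: real
    using that by (simp add: add_nonneg_pos)
  have "continuous_on {0..1} ?f"
    by (intro continuous_intros) (use pos in force)+
  then have "set_integrable lborel {0..1} ?f"
    by (rule borel_integrable_atLeastAtMost')
  then have "(LBINT x=0..1. ?f x) = integral {0..1} ?f"
    using interval_integral_eq_integral[of 0 1 ?f] by (simp add: zero_ereal_def one_ereal_def)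
  also have "\<dots> = integral {0..1} (\<lambda>x. ln (x + 1) / (x\<^sup>2 + 1) + (\<Sum>k<n. ?q k x))"
  proof (rule integral_cong)
    fix x :: real assume x: "x \<in> {0..1}"
    have q: "x\<^sup>2 - 2 * x * cos (\<theta> k) + 1 > 0" if "k < n" for k
      using x \<theta>[OF that] by (intro quadratic_pos) auto
    have "ln (x ^ m + 1) = ln ((x + 1) * (\<Prod>k<n. x\<^sup>2 - 2 * x * cos (\<theta> k) + 1))"
      unfolding odd_power_plus_one_eq_prod[OF m] \<theta>_def ..
    also have "\<dots> = ln (x + 1) + ln (\<Prod>k<n. x\<^sup>2 - 2 * x * cos (\<theta> k) + 1)"
      using x q by (intro ln_mult_pos prod_pos) auto
    also have "ln (\<Prod>k<n. x\<^sup>2 - 2 * x * cos (\<theta> k) + 1) = (\<Sum>k<n. ln (x\<^sup>2 - 2 * x * cos (\<theta> k) + 1))"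
      using q by (intro ln_prod) force+
    finally show "?f x = ln (x + 1) / (x\<^sup>2 + 1) + (\<Sum>k<n. ?q k x)"
      by (simp add: add_divide_distrib sum_divide_distrib)
  qed
  also have "\<dots> = integral {0..1} (\<lambda>x. ln (x + 1) / (x\<^sup>2 + 1 :: real)) + (\<Sum>k<n. integral {0..1} (?q k))"
  proof -
    have 1: "(\<lambda>x. ln (x + 1) / (x\<^sup>2 + 1 :: real)) integrable_on {0..1}"
      by (intro integrable_continuous_real continuous_intros) auto
    have 2: "?q k integrable_on {0..1}" if "k < n" for k
      using \<theta>[OF that] by (intro integrable_continuous_real continuous_on_log_quadratic) auto
    have "(\<lambda>x. \<Sum>k<n. ?q k x) integrable_on {0..1}"
      using 2 by (intro integrable_sum) auto
    moreover have "integral {0..1} (\<lambda>x. \<Sum>k<n. ?q k x) = (\<Sum>k<n. integral {0..1} (?q k))"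
      using 2 by (intro integral_sum) auto
    ultimately show ?thesis using integral_add[OF 1] by simp
  qed
  also have "\<dots> = pi / 8 * ln 2 + (\<Sum>k<n. pi / 4 * ln 2 - catalan_constant
      + pi / 4 * ln (1 + sin (\<theta> k)) + Ti2 (1 / \<phi> k * (sqrt (1 - (\<phi> k)\<^sup>2) - 1)))"
  proof -
    have "integral {0..1} (?q k) = pi / 4 * ln 2 - catalan_constant
      + pi / 4 * ln (1 + sin (\<theta> k)) + Ti2 (1 / \<phi> k * (sqrt (1 - (\<phi> k)\<^sup>2) - 1))" if "k < n" for k
      using log_quadratic_integral_eq[of "\<theta> k"] \<theta>[OF that]
      unfolding Ti2_eq[OF that] log_quadratic_integral_def by simp
    then show ?thesis by (simp add: integral_ln_one_plus_over_square_plus_one)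
  qed
  \<comment> \<open>With \<open>m = 2 * n + 1\<close>, the \<open>n\<close> copies of
    \<open>pi / 4 * ln 2\<close> and the single \<open>pi / 8 * ln 2\<close> add up to
    \<open>m * pi / 8 * ln 2\<close>, and \<open>n = (m - 1) / 2\<close> counts Catalan's
    constant.\<close>
  also have "\<dots> = real m * pi / 8 * ln 2 - (real m - 1) * catalan_constant / 2
      + pi / 4 * (\<Sum>k<n. ln (1 + sin (\<theta> k)))
      + (\<Sum>k<n. Ti2 (1 / \<phi> k * (sqrt (1 - (\<phi> k)\<^sup>2) - 1)))"
    unfolding sum.distrib sum_subtractf sum_distrib_left[symmetric] by (simp add: m field_simps)
  finally show ?thesis unfolding n_def \<theta>_def .
qed

end
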